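(* Let $\mathcal{K}(\mathbb{M}_2)\cong\mathbb{R}^6$ be the space of Killing $2$-tensors of the Minkowski plane with coordinates $(A,B,C,\alpha,\beta,\gamma)$, and let $G_M$, $R_0,R_1,R_2$, $S_3,S_4$ be as defined in the context. The set $S_4\setminus S_3$ contains $4$ connected components. They can be linked together using $R_0$ and either one of $R_1$ and $R_2$ (i.e. any component is mapped onto any other by some composition of these), and so they form a unique orbit of the action of $G_M$.
   Context: In the Minkowski plane $\mathbb{M}_2$ with pseudo-Cartesian coordinates $(t,x)$ and metric $\mathbf{g}$ with contravariant components $\mathrm{diag}(1,-1)$, the general Killing $2$-tensor has contravariant components $K^{11}=A+2\alpha x+\gamma x^2$, $K^{12}=K^{21}=C+\alpha t+\beta x+\gamma tx$, $K^{22}=B+2\beta t+\gamma t^2$, with $A,B,C,\alpha,\beta,\gamma\in\mathbb{R}$. So the vector space $\mathcal{K}(\mathbb{M}_2)$ of Killing $2$-tensors is identified with $\mathbb{R}^6$ with coordinates $(A,B,C,\alpha,\beta,\gamma)$. With respect to $(\partial_A,\partial_B,\partial_C,\partial_\alpha,\partial_\beta,\partial_\gamma)$ define the vector fields on $\mathcal{K}(\mathbb{M}_2)$: $V_1=(0,-2\beta,-\alpha,0,-\gamma,0)$ and $V_2=(-2\alpha,0,-\beta,-\gamma,0,0)$ (translations); $V_3=(2C,2C,A+B,\beta,\alpha,0)$ (boost); $V_4=(2A,2B,2C,\alpha,\beta,0)$ (dilatation of the plane); $V_5=(1,-1,0,0,0,0)$ (addition of a multiple of the metric); $V_6=(A,B,C,\alpha,\beta,\gamma)$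 (scalar multiplication). Discrete transformations of $\mathcal{K}(\mathbb{M}_2)$ (unlisted coordinates are unchanged): $R_0:\mathbf{K}\mapsto-\mathbf{K}$; $R_1: C\mapsto-C,\ \alpha\mapsto-\alpha$; $R_2: C\mapsto-C,\ \beta\mapsto-\beta$. $G_M$ is the group of transformations of $\mathcal{K}(\mathbb{M}_2)$ generated by the flows of $V_1,\dots,V_6$ and by $R_0,R_1,R_2$. $S_3=\{\gamma(A+B)=\alpha^2+\beta^2,\ \gamma C=\alpha\beta\}$; $S_4=\{\gamma=0,\ \alpha=\beta,\ A+B=2C\}\cup\{\gamma=0,\ \alpha=-\beta,\ A+B=-2C\}$. *)

theory Defs
  imports "HOL-Analysis.Analysis" "HOL-Algebra.Group_Action" "HOL-Algebra.Generated_Groups"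
begin

text \<open>
  Killing 2-tensors of the Minkowski plane with metric \<open>diag(1,-1)\<close> are represented by their
  parameters \<open>(A, B, C, \<alpha>, \<beta>, \<gamma>)\<close>, in this order.
\<close>

type_synonym killing = "real \<times> real \<times> real \<times> real \<times> real \<times> real"

text \<open>
  The matrix of contravariant components, at the point with pseudo-Cartesian coordinates
  \<open>(t, x)\<close>, of the Killing tensor with the given parameters. This is the identification of the
  space of Killing tensors with \<open>killing\<close>; everything below is phrased in the parameters.
\<close>

fun killing_tensor :: "killing \<Rightarrow> real \<times> real \<Rightarrow> real^2^2" where
  "killing_tensor (A, B, C, \<alpha>, \<beta>, \<gamma>) (t, x) =
     vector [vector [A + 2 * \<alpha> * x + \<gamma> * x^2,  C + \<alpha> * t + \<beta> * x + \<gamma> * t * x],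
             vector [C + \<alpha> * t + \<beta> * x + \<gamma> * t * x,  B + 2 * \<beta> * t + \<gamma> * t^2]]"

lemma inj_killing_tensor: "inj killing_tensor"
proof (rule injI)
  fix K L :: killing
  assume eq: "killing_tensor K = killing_tensor L"
  obtain A B C \<alpha> \<beta> \<gamma> where K: "K = (A, B, C, \<alpha>, \<beta>, \<gamma>)" by (cases K)
  obtain A' B' C' \<alpha>' \<beta>' \<gamma>' where L: "L = (A', B', C', \<alpha>', \<beta>', \<gamma>')" by (cases L)
  have c: "killing_tensor K p $ i $ j = killing_tensor L p $ i $ j" for p i j
    using eq by simp
  show "K = L"
    using c[of "(0, 0)" 1 1] c[of "(0, 0)" 1 2] c[of "(0, 0)" 2 2]
      c[of "(1, 0)" 1 2] c[of "(0, 1)" 1 2] c[of "(1, 1)" 1 2]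
    by (simp add: K L)
qed

text \<open>Translations, boost, dilatation, addition of a multiple of the metric, scaling:\<close>

fun V1 :: "killing \<Rightarrow> killing" where
  "V1 (A, B, C, \<alpha>, \<beta>, \<gamma>) = (0, - 2 * \<beta>, - \<alpha>, 0, - \<gamma>, 0)"

fun V2 :: "killing \<Rightarrow> killing" where
  "V2 (A, B, C, \<alpha>, \<beta>, \<gamma>) = (- 2 * \<alpha>, 0, - \<beta>, - \<gamma>, 0, 0)"

fun V3 :: "killing \<Rightarrow> killing" where
  "V3 (A, B, C, \<alpha>, \<beta>, \<gamma>) = (2 * C, 2 * C, A + B, \<beta>, \<alpha>, 0)"

fun V4 :: "killing \<Rightarrow> killing" where
  "V4 (A, B, C, \<alpha>, \<beta>, \<gamma>) = (2 * A, 2 * B, 2 * C, \<alpha>, \<beta>, 0)"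

fun V5 :: "killing \<Rightarrow> killing" where
  "V5 (A, B, C, \<alpha>, \<beta>, \<gamma>) = (1, - 1, 0, 0, 0, 0)"

fun V6 :: "killing \<Rightarrow> killing" where
  "V6 (A, B, C, \<alpha>, \<beta>, \<gamma>) = (A, B, C, \<alpha>, \<beta>, \<gamma>)"

fun R0 :: "killing \<Rightarrow> killing" where
  "R0 (A, B, C, \<alpha>, \<beta>, \<gamma>) = (- A, - B, - C, - \<alpha>, - \<beta>, - \<gamma>)"

fun R1 :: "killing \<Rightarrow> killing" where
  "R1 (A, B, C, \<alpha>, \<beta>, \<gamma>) = (A, B, - C, - \<alpha>, \<beta>, \<gamma>)"

fun R2 :: "killing \<Rightarrow> killing" where
  "R2 (A, B, C, \<alpha>, \<beta>, \<gamma>) = (A, B, - C, \<alpha>, - \<beta>, \<gamma>)"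

text \<open>
  \<open>\<phi> s\<close> is the time-\<open>s\<close> map of a complete flow. The fields above are affine, so each of them has
  exactly one such \<open>\<phi>\<close>.
\<close>

definition is_flow :: "('a::real_normed_vector \<Rightarrow> 'a) \<Rightarrow> (real \<Rightarrow> 'a \<Rightarrow> 'a) \<Rightarrow> bool" where
  "is_flow V \<phi> \<longleftrightarrow>
     (\<forall>p. \<phi> 0 p = p \<and> (\<forall>s. ((\<lambda>s. \<phi> s p) has_vector_derivative V (\<phi> s p)) (at s)))"

text \<open>
  \<open>subgroup_generated\<close> intersects the generators with the carrier, here all bijections of the
  parameter space; no generator is lost, since the time-\<open>s\<close> maps and the reflections are bijective.
\<close>

definition G_M :: "(killing \<Rightarrow> killing) monoid" where
  "G_M = subgroup_generated (BijGroup UNIV)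
     ({\<phi> s | \<phi> s V. V \<in> {V1, V2, V3, V4, V5, V6} \<and> is_flow V \<phi>} \<union> {R0, R1, R2})"

definition S3 :: "killing set" where
  "S3 = {(A, B, C, \<alpha>, \<beta>, \<gamma>). \<gamma> * (A + B) = \<alpha>^2 + \<beta>^2 \<and> \<gamma> * C = \<alpha> * \<beta>}"

definition S4 :: "killing set" where
  "S4 = {(A, B, C, \<alpha>, \<beta>, \<gamma>). \<gamma> = 0 \<and> \<alpha> = \<beta> \<and> A + B = 2 * C} \<union>
        {(A, B, C, \<alpha>, \<beta>, \<gamma>). \<gamma> = 0 \<and> \<alpha> = - \<beta> \<and> A + B = - 2 * C}"

end

theory Submission
  imports Defs
begin

text \<open>
  Write \<open>e = \<plusminus>1\<close> and let \<open>\<xi>\<close> be the null covector field \<open>(1, - e)\<close>. Evaluating the Killing tensor on it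
  gives a quadratic polynomial in the single null coordinate \<open>x - e * t\<close>:
  \<open>K(\<xi>, \<xi>) = (A + B - 2 * e * C) + 2 * (\<alpha> - e * \<beta>) * (x - e * t) + \<gamma> * (x - e * t)\<^sup>2\<close>.
  Hence \<open>S4\<close> consists of the tensors for which one of these two polynomials is identically zero, and
  removing \<open>S3\<close>, which contains exactly the points of \<open>S4\<close> with \<open>\<alpha> = \<beta> = 0\<close>, amounts to requiring that
  the other polynomial have slope \<open>\<alpha> + e * \<beta> \<noteq> 0\<close>.

  On \<open>S4 - S3\<close> neither \<open>\<alpha>\<close> nor \<open>\<beta>\<close> vanishes, and once their signs are fixed, so are
  \<open>e\<close> and a system of linear equations and strict inequalities. So \<open>S4 - S3\<close> splits into four convex
  pieces, one for each open quadrant of the \<open>(\<alpha>, \<beta>)\<close> plane, and these are the components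
  (\<open>components_S4_minus_S3\<close>). The reflections permute the quadrants: \<open>R1\<close> and \<open>R2\<close> change one
  sign each and \<open>R0\<close> changes both, so \<open>R0\<close> and either of the others generate a group that is
  transitive on the four pieces (\<open>cells_linked\<close>).

  That \<open>S4 - S3\<close> is exactly one orbit has two halves. It is invariant because isometries and
  dilatations carry null covector fields to multiples of null covector fields and the metric vanishes
  on them. Infinitesimally: the coefficients of the polynomial satisfy a triangular linear system along
  each flow (\<open>coefficients_triangular\<close>), so vanishing coefficients stay zero, and the slope of the other
  polynomial is then multiplied by an exponential, so it stays nonzero
  (\<open>flow_stays_in_S4_minus_S3\<close>). Conversely, translations and scalings already act
  transitively on the piece \<open>\<alpha> = \<beta> > 0\<close> (\<open>cell_1_1_reachable\<close>), and the reflections lead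
  from there to the others.
\<close>

section \<open>Components from a partition into open connected pieces\<close>

text \<open>
  Each piece is clopen in \<open>S\<close>, its complement being the union of the other pieces; so a connected
  subset of \<open>S\<close> that meets the piece lies inside it.
\<close>

lemma components_eq_openin_partition:
  fixes S :: "'a::topological_space set"
  assumes disj: "pairwise disjnt \<A>" and un: "\<Union>\<A> = S"
    and op: "\<And>X. X \<in> \<A> \<Longrightarrow> openin (top_of_set S) X"
    and conn: "\<And>X. X \<in> \<A> \<Longrightarrow> connected X" and ne: "\<And>X. X \<in> \<A> \<Longrightarrow> X \<noteq> {}"
  shows "components S = \<A>"
proof -
  have comp: "connected_component_set S x = X" if X: "X \<in> \<A>" and x: "x \<in> X" for X x
  proof
    let ?c = "connected_component_set S x"
    have XS: "X \<subseteq> S" using un X by blast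
    show "X \<subseteq> ?c"
      using connected_component_maximal[OF x conn[OF X] XS] .
    have cS: "?c \<subseteq> S" by (rule connected_component_subset)
    have "S - X = \<Union>(\<A> - {X})"
      using un disj X by (auto simp: pairwise_def disjnt_def)
    then have "openin (top_of_set S) (S - X)"
      using op by auto
    then have "closedin (top_of_set S) X"
      using XS by (simp add: closedin_def)
    then obtain F where "closed F" "X = S \<inter> F"
      unfolding closedin_closed by blast
    then have "closedin (top_of_set ?c) (?c \<inter> X)"
      using cS unfolding closedin_closed by blast
    moreover obtain U where "open U" "X = S \<inter> U"
      using op[OF X] unfolding openin_open by blast
    then have "openin (top_of_set ?c) (?c \<inter> X)"
      using cS unfolding openin_open by blast
    moreover have "x \<in> ?c \<inter> X"
      using x XS by auto
    moreover have "connected ?c" by simp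
    ultimately have "?c \<inter> X = ?c"
      unfolding connected_clopen by blast
    then show "?c \<subseteq> X" by blast
  qed
  show ?thesis
  proof
    show "components S \<subseteq> \<A>"
      using comp un by (force simp: components_def)
    show "\<A> \<subseteq> components S"
    proof
      fix X assume X: "X \<in> \<A>"
      then obtain x where "x \<in> X" using ne by blast
      then show "X \<in> components S"
        using comp[OF X] un X by (metis UnionI componentsI)
    qed
  qed
qed

section \<open>The four components and their permutation by the reflections\<close>

text \<open>
  For signs \<open>i\<close> and \<open>j\<close> this is the part of \<open>S4 - S3\<close> with \<open>sgn \<alpha> = i\<close> and
  \<open>sgn \<beta> = j\<close>. It lies in the branch \<open>\<alpha> = e * \<beta>\<close> of \<open>S4\<close> with \<open>e = i * j\<close>.
\<close>

definition cell :: "real \<Rightarrow> real \<Rightarrow> killing set" where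
  "cell i j = {(A, B, C, \<alpha>, \<beta>, \<gamma>). \<gamma> = 0 \<and> 0 < i * \<alpha> \<and> j * \<beta> = i * \<alpha> \<and> A + B = 2 * (i * j) * C}"

lemma S4_minus_S3_eq_cells:
  "S4 - S3 = cell 1 1 \<union> cell 1 (-1) \<union> cell (-1) 1 \<union> cell (-1) (-1)"
  by (auto simp: S4_def S3_def cell_def)

lemma convex_cell: "convex (cell i j)"
proof (rule convexI)
  fix p q :: killing and u v :: real
  assume pq: "p \<in> cell i j" "q \<in> cell i j" and uv: "0 \<le> u" "0 \<le> v" "u + v = 1"
  obtain A B C \<alpha> \<beta> \<gamma> where p: "p = (A, B, C, \<alpha>, \<beta>, \<gamma>)" by (cases p)
  obtain A' B' C' \<alpha>' \<beta>' \<gamma>' where q: "q = (A', B', C', \<alpha>', \<beta>', \<gamma>')" by (cases q)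
  have mem: "0 < i * \<alpha>" "0 < i * \<alpha>'" "j * \<beta> = i * \<alpha>" "j * \<beta>' = i * \<alpha>'" "\<gamma> = 0" "\<gamma>' = 0"
    "A + B = 2 * (i * j) * C" "A' + B' = 2 * (i * j) * C'"
    using pq by (simp_all add: p q cell_def)
  have "0 < u * (i * \<alpha>) + v * (i * \<alpha>')"
    using convexD[OF convex_real_interval(3)[of 0], of "i * \<alpha>" "i * \<alpha>'" u v] mem uv by simp
  then have "0 < i * (u * \<alpha> + v * \<alpha>')"
    by (simp add: algebra_simps)
  moreover have "j * (u * \<beta> + v * \<beta>') = u * (j * \<beta>) + v * (j * \<beta>')"
    by (simp add: algebra_simps)
  then have "j * (u * \<beta> + v * \<beta>') = i * (u * \<alpha> + v * \<alpha>')"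
    unfolding mem by (simp add: algebra_simps)
  moreover have "u * A + v * A' + (u * B + v * B') = u * (A + B) + v * (A' + B')"
    by (simp add: algebra_simps)
  then have "u * A + v * A' + (u * B + v * B') = 2 * (i * j) * (u * C + v * C')"
    unfolding mem by (simp add: algebra_simps)
  ultimately show "u *\<^sub>R p + v *\<^sub>R q \<in> cell i j"
    using mem by (simp add: p q cell_def)
qed

lemma involution_image_eqI:
  assumes "\<And>x. f (f x) = x" "\<And>x. x \<in> A \<Longrightarrow> f x \<in> B" "\<And>y. y \<in> B \<Longrightarrow> f y \<in> A"
  shows "f ` A = B"
  using assms by (metis image_eqI image_subsetI subsetI subset_antisym)

lemma reflection_image_cell:
  "R0 ` cell i j = cell (- i) (- j)"
  "R1 ` cell i j = cell (- i) j"
  "R2 ` cell i j = cell i (- j)"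
  by (rule involution_image_eqI; auto simp: cell_def)+

definition cells :: "killing set set" where
  "cells = {cell 1 1, cell 1 (-1), cell (-1) 1, cell (-1) (-1)}"

lemma point_in_cell: "i \<in> {1, -1} \<Longrightarrow> j \<in> {1, -1} \<Longrightarrow> (0, 0, 0, i, j, 0) \<in> cell i j"
  by (auto simp: cell_def)

text \<open>This form shows that the pieces are relatively open and disjoint.\<close>

lemma cell_eq_Int_quadrant:
  assumes "i \<in> {1, -1}" "j \<in> {1, -1}"
  shows "cell i j = (S4 - S3) \<inter> {(A, B, C, \<alpha>, \<beta>, \<gamma>). 0 < i * \<alpha> \<and> 0 < j * \<beta>}"
  using assms unfolding S4_minus_S3_eq_cells by (auto simp: cell_def)

lemma components_S4_minus_S3: "components (S4 - S3) = cells"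
proof (rule components_eq_openin_partition)
  have "disjnt (cell i j) (cell i' j')"
    if "i \<in> {1, -1}" "j \<in> {1, -1}" "i' \<in> {1, -1}" "j' \<in> {1, -1}" "(i, j) \<noteq> (i', j')" for i j i' j'
    using that by (auto simp: cell_eq_Int_quadrant disjnt_def)
  then show "pairwise disjnt cells"
    unfolding cells_def pairwise_def by (smt (verit, best) insert_iff prod.inject empty_iff)
  show "\<Union>cells = S4 - S3"
    by (auto simp: cells_def S4_minus_S3_eq_cells)
next
  fix X assume "X \<in> cells"
  then obtain i j where X: "X = cell i j" and ij: "i \<in> {1, -1}" "j \<in> {1, -1}"
    by (auto simp: cells_def)
  have "open {(A::real, B::real, C::real, \<alpha>, \<beta>, \<gamma>::real). 0 < i * \<alpha> \<and> 0 < j * \<beta>}"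
    unfolding case_prod_beta by (intro open_Collect_conj open_Collect_less continuous_intros)
  then show "openin (top_of_set (S4 - S3)) X"
    using X cell_eq_Int_quadrant[OF ij] by (simp add: openin_open_Int)
  show "connected X"
    using X convex_cell convex_connected by blast
  show "X \<noteq> {}"
    using X point_in_cell[OF ij] by blast
qed

lemma card_cells: "card cells = 4"
proof -
  have "(0, 0, 0, 1, 1, 0) \<in> cell i j \<longleftrightarrow> i = 1 \<and> j = 1"
    "(0, 0, 0, 1, -1, 0) \<in> cell i j \<longleftrightarrow> i = 1 \<and> j = -1"
    "(0, 0, 0, -1, 1, 0) \<in> cell i j \<longleftrightarrow> i = -1 \<and> j = 1"
    if "i \<in> {1, -1}" "j \<in> {1, -1}" for i j
    using that by (auto simp: cell_def)
  then have "cell 1 1 \<noteq> cell 1 (-1)" "cell 1 1 \<noteq> cell (-1) 1" "cell 1 1 \<noteq> cell (-1) (-1)"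
    "cell 1 (-1) \<noteq> cell (-1) 1" "cell 1 (-1) \<noteq> cell (-1) (-1)" "cell (-1) 1 \<noteq> cell (-1) (-1)"
    by (metis insertI1 insertI2 one_neq_neg_one)+
  then show ?thesis by (simp add: cells_def)
qed

text \<open>
  As sign changes, \<open>R0\<close> is \<open>(-, -)\<close> and \<open>R\<close> is \<open>(-, +)\<close> or \<open>(+, -)\<close>. Together they
  generate the Klein four-group of all sign changes.
\<close>

lemma cells_linked:
  assumes R: "R \<in> {R1, R2}" and "X \<in> cells" "Y \<in> cells"
  shows "\<exists>fs. set fs \<subseteq> {R0, R} \<and> foldr (\<circ>) fs id ` X = Y"
proof -
  obtain i j i' j' where X: "X = cell i j" and Y: "Y = cell i' j'"
    and "i \<in> {1, -1}" "j \<in> {1, -1}" "i' \<in> {1, -1}" "j' \<in> {1, -1}"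
    using assms(2,3) by (auto simp: cells_def)
  then have signs: "i' = i \<or> i' = - i" "j' = j \<or> j' = - j" by auto
  consider "R = R1" | "R = R2" using R by blast
  then have "Y = X \<or> Y = R0 ` X \<or> Y = R ` X \<or> Y = R0 ` R ` X"
  proof cases
    case 1
    show ?thesis unfolding X Y 1 reflection_image_cell using signs by (elim disjE) simp_all
  next
    case 2
    show ?thesis unfolding X Y 2 reflection_image_cell using signs by (elim disjE) simp_all
  qed
  then consider "Y = X" | "Y = R0 ` X" | "Y = R ` X" | "Y = R0 ` R ` X" by blast
  then show ?thesis
  proof cases
    case 1
    then show ?thesis by (intro exI[of _ "[]"]) simp
  next
    case 2
    then show ?thesis by (intro exI[of _ "[R0]"]) simp
  next
    case 3
    then show ?thesis by (intro exI[of _ "[R]"]) simp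
  next
    case 4
    then show ?thesis by (intro exI[of _ "[R0, R]"]) (simp add: image_comp)
  qed
qed

section \<open>Null coefficients along the flows\<close>

text \<open>
  The coefficients of \<open>K(\<xi>, \<xi>) = null_const e K + 2 * null_slope e K * (x - e * t) +
  null_quad K * (x - e * t)\<^sup>2\<close> for the null covector \<open>\<xi> = (1, - e)\<close>. The quadratic one does not
  depend on \<open>e\<close>.
\<close>

definition null_const :: "real \<Rightarrow> killing \<Rightarrow> real" where
  "null_const e = (\<lambda>(A, B, C, \<alpha>, \<beta>, \<gamma>). A + B - 2 * e * C)"

definition null_slope :: "real \<Rightarrow> killing \<Rightarrow> real" where
  "null_slope e = (\<lambda>(A, B, C, \<alpha>, \<beta>, \<gamma>). \<alpha> - e * \<beta>)"

definition null_quad :: "killing \<Rightarrow> real" where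
  "null_quad = (\<lambda>(A, B, C, \<alpha>, \<beta>, \<gamma>). \<gamma>)"

lemma bounded_linear_coefficients:
  "bounded_linear (null_const e)" "bounded_linear (null_slope e)" "bounded_linear null_quad"
  unfolding linear_conv_bounded_linear[symmetric]
  by (auto intro!: linearI simp: null_const_def null_slope_def null_quad_def algebra_simps)

lemma mem_S4_minus_S3_iff:
  "p \<in> S4 - S3 \<longleftrightarrow> (\<exists>e\<in>{1, -1}.
     null_quad p = 0 \<and> null_slope e p = 0 \<and> null_const e p = 0 \<and> null_slope (- e) p \<noteq> 0)"
  by (cases p) (auto simp: S4_def S3_def null_const_def null_slope_def null_quad_def)

text \<open>
  Translating the null coordinate changes a coefficient by multiples of the coefficients of higher
  degree, whereas boosts, dilatations and scalings act on each coefficient by a scalar. The field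
  \<open>V5\<close> adds \<open>1 - 1 = 0\<close> to \<open>null_const e\<close>.
\<close>

lemma coefficients_triangular:
  assumes "V \<in> {V1, V2, V3, V4, V5, V6}" "e \<in> {1, -1}"
  shows "\<exists>k0 k1 k2 m1 m2. \<forall>p. null_quad (V p) = k0 * null_quad p \<and>
    null_slope e (V p) = k1 * null_slope e p + m1 * null_quad p \<and>
    null_const e (V p) = k2 * null_const e p + m2 * null_slope e p" (is "\<exists>k0 k1 k2 m1 m2. ?P k0 k1 k2 m1 m2")
proof -
  have e: "e * e = 1" "e * (e * c) = c" for c using assms by auto
  note [simp] = null_const_def null_slope_def null_quad_def algebra_simps e
  consider "V = V1" | "V = V2" | "V = V3" | "V = V4" | "V = V5" | "V = V6" using assms by blast
  then show ?thesis
  proof cases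
    case 1
    then have "?P 0 0 0 e (2 * e)" by auto
    then show ?thesis by blast
  next
    case 2
    then have "?P 0 0 0 (-1) (-2)" by auto
    then show ?thesis by blast
  next
    case 3
    then have "?P 0 (- e) (- 2 * e) 0 0" by auto
    then show ?thesis by blast
  next
    case 4
    then have "?P 0 1 2 0 0" by auto
    then show ?thesis by blast
  next
    case 5
    then have "?P 0 0 0 0 0" by auto
    then show ?thesis by blast
  next
    case 6
    then have "?P 1 1 1 0 0" by auto
    then show ?thesis by blast
  qed
qed

text \<open>
  This takes the place of a uniqueness theorem for the flows: along a given trajectory the function
  \<open>f(\<phi> r p) * exp (- k * r)\<close> has derivative zero. Since the equation is required along
  the trajectory, it may be derived from the vanishing of other coefficients there.
\<close>

lemma flow_functional_exp:
  fixes f :: "'a::real_normed_vector \<Rightarrow> real"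
  assumes flow: "is_flow V \<phi>" and f: "bounded_linear f"
    and eig: "\<And>s. f (V (\<phi> s p)) = k * f (\<phi> s p)"
  shows "f (\<phi> t p) = f (\<phi> s p) * exp (k * (t - s))"
proof -
  have "((\<lambda>s. f (\<phi> s p)) has_real_derivative k * f (\<phi> r p)) (at r)" for r
    using bounded_linear.has_vector_derivative[OF f] flow eig
    unfolding is_flow_def has_real_derivative_iff_has_vector_derivative by metis
  then have "((\<lambda>r. f (\<phi> r p) * exp (- k * r)) has_real_derivative 0) (at r)" for r
    by (auto intro!: derivative_eq_intros simp: algebra_simps)
  then have "f (\<phi> t p) * exp (- k * t) = f (\<phi> s p) * exp (- k * s)"
    by (intro DERIV_isconst_all) auto
  then have "f (\<phi> t p) * (exp (- k * t) * exp (k * t)) = f (\<phi> s p) * (exp (- k * s) * exp (k * t))"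
    by (simp only: mult.assoc[symmetric])
  then show ?thesis
    by (simp add: exp_add[symmetric] right_diff_distrib)
qed

text \<open>
  The triangular system is solved from the top: once the higher coefficients are known to be zero
  along the whole trajectory, the next one solves \<open>y' = k * y\<close>. Starting at an arbitrary time \<open>s\<close>
  rather than \<open>0\<close> covers the inverses of the time maps as well.
\<close>

lemma flow_stays_in_S4_minus_S3:
  assumes V: "V \<in> {V1, V2, V3, V4, V5, V6}" and flow: "is_flow V \<phi>"
    and start: "\<phi> s p \<in> S4 - S3"
  shows "\<phi> t p \<in> S4 - S3"
proof -
  obtain e where e: "e \<in> {1, -1}" and g: "null_quad (\<phi> s p) = 0" and u: "null_slope e (\<phi> s p) = 0"
    and w: "null_const e (\<phi> s p) = 0" and v: "null_slope (- e) (\<phi> s p) \<noteq> 0"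
    using start unfolding mem_S4_minus_S3_iff by blast
  obtain k0 k1 k2 m1 m2 where tri: "\<forall>p. null_quad (V p) = k0 * null_quad p \<and>
      null_slope e (V p) = k1 * null_slope e p + m1 * null_quad p \<and>
      null_const e (V p) = k2 * null_const e p + m2 * null_slope e p"
    using coefficients_triangular[OF V e] by blast
  have e': "- e \<in> {1, -1}" using e by auto
  obtain k m where tri': "\<And>p. null_slope (- e) (V p) = k * null_slope (- e) p + m * null_quad p"
    using coefficients_triangular[OF V e'] by blast
  have g0: "null_quad (\<phi> r p) = 0" for r
  proof -
    have "null_quad (\<phi> r p) = null_quad (\<phi> s p) * exp (k0 * (r - s))"
      by (rule flow_functional_exp[OF flow bounded_linear_coefficients(3)]) (simp add: tri)
    then show ?thesis by (simp add: g)
  qed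
  have u0: "null_slope e (\<phi> r p) = 0" for r
  proof -
    have "null_slope e (\<phi> r p) = null_slope e (\<phi> s p) * exp (k1 * (r - s))"
      by (rule flow_functional_exp[OF flow bounded_linear_coefficients(2)]) (simp add: tri g0)
    then show ?thesis by (simp add: u)
  qed
  have w0: "null_const e (\<phi> r p) = 0" for r
  proof -
    have "null_const e (\<phi> r p) = null_const e (\<phi> s p) * exp (k2 * (r - s))"
      by (rule flow_functional_exp[OF flow bounded_linear_coefficients(1)]) (simp add: tri u0)
    then show ?thesis by (simp add: w)
  qed
  have v0: "null_slope (- e) (\<phi> r p) \<noteq> 0" for r
  proof -
    have "null_slope (- e) (\<phi> r p) = null_slope (- e) (\<phi> s p) * exp (k * (r - s))"
      by (rule flow_functional_exp[OF flow bounded_linear_coefficients(2)]) (simp add: tri' g0)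
    then show ?thesis by (simp add: v)
  qed
  show ?thesis
    unfolding mem_S4_minus_S3_iff by (intro bexI[of _ e] conjI g0 u0 w0 v0 e)
qed

section \<open>Invariance under the group\<close>

definition G_M_generators :: "(killing \<Rightarrow> killing) set" where
  "G_M_generators = {\<phi> s | \<phi> s V. V \<in> {V1, V2, V3, V4, V5, V6} \<and> is_flow V \<phi>} \<union> {R0, R1, R2}"

lemma flow_in_generators:
  "V \<in> {V1, V2, V3, V4, V5, V6} \<Longrightarrow> is_flow V \<phi> \<Longrightarrow> \<phi> s \<in> G_M_generators"
  unfolding G_M_generators_def by blast

lemma Bij_UNIV: "Bij UNIV = {f. bij f}"
  by (simp add: Bij_def)

lemma carrier_G_M:
  "carrier G_M = generate (BijGroup UNIV) ({g. bij g} \<inter> G_M_generators)"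
proof -
  have "carrier (BijGroup UNIV) = {g :: killing \<Rightarrow> killing. bij g}"
    by (simp add: BijGroup_def Bij_UNIV)
  then show ?thesis
    by (simp only: G_M_def G_M_generators_def carrier_subgroup_generated)
qed

lemma generator_in_G_M: "g \<in> G_M_generators \<Longrightarrow> bij g \<Longrightarrow> g \<in> carrier G_M"
  unfolding carrier_G_M by (rule generate.incl) blast

lemma generate_BijGroup_subset: "generate (BijGroup UNIV) ({g. bij g} \<inter> H) \<subseteq> {g. bij g}"
  using group.generate_incl[OF group_BijGroup, of "{g. bij g} \<inter> H" UNIV]
  by (auto simp: BijGroup_def Bij_UNIV)

lemma mult_BijGroup_UNIV: "bij g \<Longrightarrow> bij f \<Longrightarrow> g \<otimes>\<^bsub>BijGroup UNIV\<^esub> f = g \<circ> f"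
  by (auto simp: BijGroup_def Bij_UNIV compose_def)

lemma bij_of_G_M: "g \<in> carrier G_M \<Longrightarrow> bij g"
  unfolding carrier_G_M by (drule subsetD[OF generate_BijGroup_subset]) (simp only: mem_Collect_eq)

lemma comp_in_G_M:
  assumes "f \<in> carrier G_M" "g \<in> carrier G_M"
  shows "f \<circ> g \<in> carrier G_M"
proof -
  have "f \<otimes>\<^bsub>BijGroup UNIV\<^esub> g \<in> carrier G_M"
    using assms unfolding carrier_G_M by (rule generate.eng)
  then show ?thesis
    by (simp only: mult_BijGroup_UNIV bij_of_G_M assms)
qed

lemma id_in_G_M: "id \<in> carrier G_M"
proof -
  have "\<one>\<^bsub>BijGroup UNIV\<^esub> = (id :: killing \<Rightarrow> killing)"
    by (auto simp: BijGroup_def)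
  moreover have "\<one>\<^bsub>BijGroup UNIV\<^esub> \<in> carrier G_M"
    unfolding carrier_G_M by (rule generate.one)
  ultimately show ?thesis by simp
qed

lemma reflections_in_G_M: "{R0, R1, R2} \<subseteq> carrier G_M"
proof -
  have "R0 \<circ> R0 = id" "R1 \<circ> R1 = id" "R2 \<circ> R2 = id" by (auto simp: fun_eq_iff)
  then have "bij R0" "bij R1" "bij R2" by (auto intro: o_bij)
  then show ?thesis by (auto intro!: generator_in_G_M simp: G_M_generators_def)
qed

lemma foldr_comp_in_G_M: "set fs \<subseteq> carrier G_M \<Longrightarrow> foldr (\<circ>) fs id \<in> carrier G_M"
  by (induction fs) (auto simp: id_in_G_M intro!: comp_in_G_M)

text \<open>
  The generators have to satisfy an equivalence, as an inclusion in one direction would not pass to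
  inverses.
\<close>

lemma G_M_preserves:
  assumes "g \<in> carrier G_M"
    and gen: "\<And>h p. h \<in> G_M_generators \<Longrightarrow> h p \<in> T \<longleftrightarrow> p \<in> T"
  shows "g p \<in> T \<longleftrightarrow> p \<in> T"
  using assms(1) unfolding carrier_G_M
proof (induction arbitrary: p rule: generate.induct)
  case one
  show ?case by (simp add: BijGroup_def)
next
  case (incl h)
  then show ?case using gen by blast
next
  case (inv h)
  then have h: "bij h" "h \<in> G_M_generators" by auto
  then have "inv\<^bsub>BijGroup UNIV\<^esub> h = inv_into UNIV h"
    using inv_BijGroup[of h UNIV] by (simp add: Bij_UNIV restrict_def)
  then show ?case
    using gen[OF h(2), of "inv_into UNIV h p"] h(1) by (simp add: bij_is_surj surj_f_inv_f)
next
  case (eng h1 h2)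
  have "bij h1" "bij h2"
    using eng.hyps bij_of_G_M unfolding carrier_G_M by blast+
  then show ?case
    by (simp only: mult_BijGroup_UNIV comp_apply eng.IH)
qed

lemma G_M_preserves_S4_minus_S3:
  assumes "g \<in> carrier G_M"
  shows "g p \<in> S4 - S3 \<longleftrightarrow> p \<in> S4 - S3"
  using assms
proof (rule G_M_preserves)
  fix h :: "killing \<Rightarrow> killing" and p
  assume "h \<in> G_M_generators"
  then consider \<phi> s V where "h = \<phi> s" "V \<in> {V1, V2, V3, V4, V5, V6}" "is_flow V \<phi>"
    | "h \<in> {R0, R1, R2}" unfolding G_M_generators_def by blast
  then show "h p \<in> S4 - S3 \<longleftrightarrow> p \<in> S4 - S3"
  proof cases
    case 1
    from 1(3) have "\<phi> 0 p = p" unfolding is_flow_def by blast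
    then show ?thesis
      using flow_stays_in_S4_minus_S3[OF 1(2,3), of s p 0]
        flow_stays_in_S4_minus_S3[OF 1(2,3), of 0 p s] unfolding 1(1) by argo
  next
    case 2
    then show ?thesis by (cases p) (auto simp: S4_def S3_def)
  qed
qed

section \<open>Transitivity\<close>

text \<open>
  The translation flows are unipotent linear maps; the quadratic terms in \<open>s\<close> come from
  \<open>\<beta>\<close>, respectively \<open>\<alpha>\<close>, drifting with speed \<open>- \<gamma>\<close>.
\<close>

definition flow_V1 :: "real \<Rightarrow> killing \<Rightarrow> killing" where
  "flow_V1 s = (\<lambda>(A, B, C, \<alpha>, \<beta>, \<gamma>). (A, B - 2 * \<beta> * s + \<gamma> * s^2, C - \<alpha> * s, \<alpha>, \<beta> - \<gamma> * s, \<gamma>))"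

definition flow_V2 :: "real \<Rightarrow> killing \<Rightarrow> killing" where
  "flow_V2 s = (\<lambda>(A, B, C, \<alpha>, \<beta>, \<gamma>). (A - 2 * \<alpha> * s + \<gamma> * s^2, B, C - \<beta> * s, \<alpha> - \<gamma> * s, \<beta>, \<gamma>))"

definition flow_V6 :: "real \<Rightarrow> killing \<Rightarrow> killing" where
  "flow_V6 s = (\<lambda>p. exp s *\<^sub>R p)"

lemma is_flow_explicit: "is_flow V1 flow_V1" "is_flow V2 flow_V2" "is_flow V6 flow_V6"
proof -
  show "is_flow V1 flow_V1" "is_flow V2 flow_V2"
    unfolding is_flow_def flow_V1_def flow_V2_def
    by (auto intro!: derivative_eq_intros has_vector_derivative_Pair
        simp: has_real_derivative_iff_has_vector_derivative[symmetric] zero_prod_def)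
  have "V6 p = p" for p by (cases p) simp
  then show "is_flow V6 flow_V6"
    unfolding is_flow_def flow_V6_def
    by (auto intro!: derivative_eq_intros
        simp: has_real_derivative_iff_has_vector_derivative[symmetric])
qed

lemma flows_in_G_M: "flow_V1 s \<in> carrier G_M" "flow_V2 s \<in> carrier G_M" "flow_V6 s \<in> carrier G_M"
proof -
  have inv: "flow_V1 s \<circ> flow_V1 (- s) = id" "flow_V2 s \<circ> flow_V2 (- s) = id" "flow_V6 s \<circ> flow_V6 (- s) = id" for s
    by (auto simp: fun_eq_iff flow_V1_def flow_V2_def flow_V6_def power2_eq_square algebra_simps
        exp_add[symmetric])
  then have "bij (flow_V1 s)" "bij (flow_V2 s)" "bij (flow_V6 s)"
    using inv[of "- s"] by (auto intro: o_bij)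
  then show "flow_V1 s \<in> carrier G_M" "flow_V2 s \<in> carrier G_M" "flow_V6 s \<in> carrier G_M"
    using flow_in_generators is_flow_explicit by (blast intro: generator_in_G_M)+
qed

lemma cell_1_1_reachable:
  assumes "p \<in> cell 1 1"
  obtains g where "g \<in> carrier G_M" "g (0, 0, 0, 1, 1, 0) = p"
proof -
  obtain A B C b where "p = (A, B, C, b, b, 0)" and b: "0 < b" and "A + B = 2 * C"
    using assms by (auto simp: cell_def)
  then have p: "p = (A, B, (A + B) / 2, b, b, 0)" by simp
  \<comment> \<open>Scaling by \<open>b\<close> leads to \<open>(0, 0, 0, b, b, 0)\<close>; from there the two translation flows move \<open>A\<close>
    and \<open>B\<close> independently with speed \<open>- 2 * b\<close>, which gives the times, and \<open>C\<close> follows because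
    both flows preserve \<open>A + B = 2 * C\<close>.\<close>
  let ?g = "flow_V1 (- B / (2 * b)) \<circ> (flow_V2 (- A / (2 * b)) \<circ> flow_V6 (ln b))"
  have "?g \<in> carrier G_M"
    by (intro comp_in_G_M flows_in_G_M)
  moreover have "?g (0, 0, 0, 1, 1, 0) = p"
    using b by (simp add: p flow_V1_def flow_V2_def flow_V6_def field_simps)
  ultimately show thesis using that by blast
qed

theorem proposition25:
  shows "card (components (S4 - S3)) = 4
    \<and> (\<forall>R \<in> {R1, R2}. \<forall>X \<in> components (S4 - S3). \<forall>Y \<in> components (S4 - S3).
         \<exists>fs. set fs \<subseteq> {R0, R} \<and> foldr (\<circ>) fs id ` X = Y)
    \<and> S4 - S3 \<in> orbits G_M UNIV (\<lambda>g. g)"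
proof (intro conjI)
  show "card (components (S4 - S3)) = 4"
    by (simp add: components_S4_minus_S3 card_cells)
  show "\<forall>R \<in> {R1, R2}. \<forall>X \<in> components (S4 - S3). \<forall>Y \<in> components (S4 - S3).
         \<exists>fs. set fs \<subseteq> {R0, R} \<and> foldr (\<circ>) fs id ` X = Y"
    unfolding components_S4_minus_S3 using cells_linked by blast
  let ?o = "(0, 0, 0, 1, 1, 0) :: killing"
  have o: "?o \<in> S4 - S3" by (simp add: S4_def S3_def)
  have "S4 - S3 = orbit G_M (\<lambda>g. g) ?o"
  proof
    show "orbit G_M (\<lambda>g. g) ?o \<subseteq> S4 - S3"
      unfolding orbit_def using iffD2[OF G_M_preserves_S4_minus_S3 o] by blast
    show "S4 - S3 \<subseteq> orbit G_M (\<lambda>g. g) ?o"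
    proof
      fix p assume "p \<in> S4 - S3"
      then obtain Y where Y: "Y \<in> cells" "p \<in> Y"
        unfolding components_S4_minus_S3[symmetric] by (metis Union_components UnionE)
      obtain fs where fs: "set fs \<subseteq> {R0, R1}" "foldr (\<circ>) fs id ` cell 1 1 = Y"
        using cells_linked[of R1 "cell 1 1" Y] Y(1) unfolding cells_def by blast
      obtain q where q: "q \<in> cell 1 1" "p = foldr (\<circ>) fs id q"
        using fs(2) Y(2) by blast
      obtain g where g: "g \<in> carrier G_M" "g ?o = q"
        using cell_1_1_reachable[OF q(1)] .
      have "set fs \<subseteq> carrier G_M"
        using fs(1) reflections_in_G_M by blast
      then have "foldr (\<circ>) fs id \<circ> g \<in> carrier G_M"
        by (intro comp_in_G_M foldr_comp_in_G_M g(1))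
      moreover have "p = (foldr (\<circ>) fs id \<circ> g) ?o"
        using q(2) g(2) by simp
      ultimately show "p \<in> orbit G_M (\<lambda>g. g) ?o"
        unfolding orbit_def by blast
    qed
  qed
  then show "S4 - S3 \<in> orbits G_M UNIV (\<lambda>g. g)"
    unfolding orbits_def by blast
qed

end
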